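(* Let $k\ge 9$ be an integer and $r\in(r_{core}(k),r_{sat}(k))$, and let $\mathbf{\Phi}\sim\mathbf{\Phi}_k(n,rn)$. Then the output $\mathtt{DEC}_{UC}(\mathbf{\Phi})$ of the $\mathtt{UC}$-decimation algorithm satisfies $$\lim_{n\to\infty}\Pr\big[\mathtt{DEC}_{UC}(\mathbf{\Phi})\in\mathcal{S}(\mathbf{\Phi})\big]=0.$$
   Context: A $k$-XORSAT instance on Boolean variables $x_1,\dots,x_n$ is a set of clauses, each a $GF(2)$ equation $x_{j_1}\oplus\cdots\oplus x_{j_k}=b$; $\mathcal{S}(\Phi)\subseteq\{0,1\}^n$ is its set of satisfying assignments. $\mathbf{\Phi}\sim\mathbf{\Phi}_k(n,m)$ means each of $m$ clauses is drawn independently and uniformly among all $2\binom{n}{k}$ possibilities. The factor graph is the bipartite variable–clause incidence graph; $B_\Phi(x,R)$ is the sub-instance induced by nodes at distance $\le R$ from $x$, rooted at $x$. For a local rule $\tau$ (a map from rooted instances of radius $R$ to $[0,1]$), the $\tau$-decimation algorithm sets $\Phi_0=\Phi$ and for $t=0,\dots,n-1$: selects an unassigned variable $x^*$ uniformly at random, sets $\sigma(x^* )=1$ with probability $\tau(B_{\Phi_t}(x^*,R))$ and $0$ otherwise, then forms $\Phi_{t+1}$ by removing $x^*$, adding $\sigma(x^* )$ to the right-hand side of each clause that contained $x^*$, and deleting clauses with no variables left; it outputs $\sigma$. The Unit Clause rule $\mathtt{UC}$ (radius $2$): if some clause of the current instance contains $x^*$ as its only variable (a unit clause), output the right-hand side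 of such a clause (the one of lowest index if several); otherwise output $1/2$. $\mathtt{DEC}_{UC}$ is the $\tau$-decimation algorithm with $\tau=\mathtt{UC}$. $r_{core}(k)=\sup\{r\in[0,1]: Q>1-e^{-krQ^{k-1}}\ \forall Q\in(0,1)\}$; $r_{sat}(k)$ is the satisfiability threshold of random $k$-XORSAT (the constant, known to exist and exceed $r_{core}(k)$, such that $\mathbf{\Phi}_k(n,rn)$ is satisfiable with probability $\to1$ for $r<r_{sat}(k)$ and unsatisfiable with probability $\to 1$ for $r>r_{sat}(k)$). *)

theory Defs
  imports "HOL-Probability.Probability" "HOL-Library.Z2"
begin

section \<open>XORSAT instances\<close>

text \<open>
  A clause is the pair of the set of its variables and its right-hand side. The clauses of an
  instance carry indices, so that a clause may occur repeatedly and keeps its index when the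
  instance is modified.
\<close>

type_synonym clause = "nat set \<times> bit"

record xorsat =
  vars :: "nat set"
  clauses :: "nat \<rightharpoonup> clause"

definition solutions :: "xorsat \<Rightarrow> (nat \<Rightarrow> bit) set" where
  "solutions \<Phi> = {\<sigma> \<in> vars \<Phi> \<rightarrow>\<^sub>E UNIV.
     \<forall>i S b. clauses \<Phi> i = Some (S, b) \<longrightarrow> (\<Sum>x\<in>S. \<sigma> x) = b}"

definition all_clauses :: "nat \<Rightarrow> nat \<Rightarrow> clause set" where
  "all_clauses k n = {S. S \<subseteq> {1..n} \<and> card S = k} \<times> UNIV"

definition random_xorsat :: "nat \<Rightarrow> nat \<Rightarrow> nat \<Rightarrow> xorsat pmf" where
  "random_xorsat k n m =
     map_pmf (\<lambda>C. \<lparr>vars = {1..n}, clauses = C\<rparr>)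
       (Pi_pmf {1..m} None (\<lambda>_. map_pmf Some (pmf_of_set (all_clauses k n))))"


section \<open>Factor graph and local neighbourhoods\<close>

datatype fnode = VarNode nat | ClauseNode nat

definition factor_graph :: "xorsat \<Rightarrow> fnode rel" where
  "factor_graph \<Phi> =
     (let E = {(VarNode x, ClauseNode i) | x i S b.
                 x \<in> vars \<Phi> \<and> clauses \<Phi> i = Some (S, b) \<and> x \<in> S}
      in E \<union> E\<inverse>)"

definition fdist :: "xorsat \<Rightarrow> fnode \<Rightarrow> fnode \<Rightarrow> enat" where
  "fdist \<Phi> u v = (INF l \<in> {l. (u, v) \<in> factor_graph \<Phi> ^^ l}. enat l)"

text \<open>
  A rooted instance is an instance together with one of its variables. In the induced
  sub-instance a clause retains those of its variables that lie in the ball.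
\<close>

definition neighbourhood :: "xorsat \<Rightarrow> nat \<Rightarrow> nat \<Rightarrow> xorsat \<times> nat" where
  "neighbourhood \<Phi> x R =
     (let V = {y \<in> vars \<Phi>. fdist \<Phi> (VarNode x) (VarNode y) \<le> enat R}
      in (\<lparr>vars = V,
           clauses = (\<lambda>i. case clauses \<Phi> i of None \<Rightarrow> None
                        | Some (S, b) \<Rightarrow>
                            if fdist \<Phi> (VarNode x) (ClauseNode i) \<le> enat R
                            then Some (S \<inter> V, b) else None)\<rparr>, x))"


section \<open>Decimation\<close>

type_synonym local_rule = "xorsat \<times> nat \<Rightarrow> real"

definition assign_var :: "xorsat \<Rightarrow> nat \<Rightarrow> bit \<Rightarrow> xorsat" where
  "assign_var \<Phi> x a =
     \<lparr>vars = vars \<Phi> - {x},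
      clauses = (\<lambda>i. case clauses \<Phi> i of None \<Rightarrow> None
                   | Some (S, b) \<Rightarrow>
                       if x \<notin> S then Some (S, b)
                       else if S - {x} = {} then None
                       else Some (S - {x}, b + a))\<rparr>"

primrec decimate_steps ::
    "nat \<Rightarrow> local_rule \<Rightarrow> nat \<Rightarrow> xorsat \<Rightarrow> (nat \<Rightarrow> bit) \<Rightarrow> (nat \<Rightarrow> bit) pmf" where
  "decimate_steps R \<tau> 0 \<Phi> \<sigma> = return_pmf \<sigma>"
| "decimate_steps R \<tau> (Suc t) \<Phi> \<sigma> =
     bind_pmf (pmf_of_set (vars \<Phi>)) (\<lambda>x.
     bind_pmf (map_pmf of_bool (bernoulli_pmf (\<tau> (neighbourhood \<Phi> x R)))) (\<lambda>a.
     decimate_steps R \<tau> t (assign_var \<Phi> x a) (\<sigma>(x := a))))"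

text \<open>
  Starting from the everywhere undefined function makes the output an extensional function on
  the variables of the instance.
\<close>

definition decimation :: "nat \<Rightarrow> local_rule \<Rightarrow> xorsat \<Rightarrow> (nat \<Rightarrow> bit) pmf" where
  "decimation R \<tau> \<Phi> = decimate_steps R \<tau> (card (vars \<Phi>)) \<Phi> (\<lambda>_. undefined)"

definition UC :: local_rule where
  "UC = (\<lambda>(\<Psi>, x).
     if \<exists>i b. clauses \<Psi> i = Some ({x}, b)
     then of_bit (snd (the (clauses \<Psi> (LEAST i. \<exists>b. clauses \<Psi> i = Some ({x}, b)))))
     else 1 / 2)"

definition DEC_UC :: "xorsat \<Rightarrow> (nat \<Rightarrow> bit) pmf" where
  "DEC_UC = decimation 2 UC"


section \<open>Thresholds\<close>

definition r_core :: "nat \<Rightarrow> real" where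
  "r_core k = Sup {r \<in> {0..1}. \<forall>Q \<in> {0<..<1}. Q > 1 - exp (- (real k * r * Q ^ (k - 1)))}"

definition is_sat_threshold :: "nat \<Rightarrow> real \<Rightarrow> bool" where
  "is_sat_threshold k s \<longleftrightarrow> (\<forall>r\<ge>0.
     (r < s \<longrightarrow>
       (\<lambda>n. measure_pmf.prob (random_xorsat k n (nat \<lfloor>r * real n\<rfloor>)) {\<Phi>. solutions \<Phi> \<noteq> {}})
         \<longlonglongrightarrow> 1) \<and>
     (r > s \<longrightarrow>
       (\<lambda>n. measure_pmf.prob (random_xorsat k n (nat \<lfloor>r * real n\<rfloor>)) {\<Phi>. solutions \<Phi> = {}})
         \<longlonglongrightarrow> 1))"

definition r_sat :: "nat \<Rightarrow> real" where
  "r_sat k = (THE s. is_sat_threshold k s)"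

end

theory Submission
  imports Defs "HOL-Real_Asymp.Real_Asymp"
begin

text \<open>
  Unit clause decimation visits the variables in a uniformly random order, independent of the
  clauses, and a variable is forced exactly when it is the last variable of some clause. For fixed
  variable sets and a fixed order with \<open>D\<close> distinct last variables, a solution \<open>\<sigma>\<close> is the output with
  probability \<open>2\<close> to the power \<open>D - n\<close>, and \<open>\<sigma>\<close> is a solution with probability \<open>2\<close> to the power \<open>-m\<close>
  over the right-hand sides. Summing over the \<open>2\<close> to the power \<open>n\<close> assignments, the success
  probability is the mean of \<open>2\<close> to the power \<open>D - m\<close>.

  Once linearly many variables are last variables of earlier clauses, a new clause lies entirely
  within this set, and hence repeats a last variable, with probability bounded away from \<open>0\<close>.
  So \<open>m - D\<close> is linear in \<open>n\<close>, and the success probability is exponentially small.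
\<close>

section \<open>Decimation along a random order\<close>

text \<open>With \<open>xs\<close> read as the order of decimation and \<open>S\<close> inside it,
  this is the only variable that can be selected while the clause on \<open>S\<close> is a unit
  clause. If \<open>S\<close> misses \<open>xs\<close> the value is unspecified.\<close>

definition last_in :: "'a list \<Rightarrow> 'a set \<Rightarrow> 'a" where
  "last_in xs S = last (filter (\<lambda>x. x \<in> S) xs)"

text \<open>The selector \<open>L\<close> is a parameter because the later counting uses only
  \<open>L S \<in> S\<close>. As an image, it counts clauses sharing a last variable once.\<close>

definition lasts :: "(nat set \<Rightarrow> nat) \<Rightarrow> (nat \<rightharpoonup> clause) \<Rightarrow> nat set" where
  "lasts L C = (\<lambda>(S, b). L S) ` ran C"

text \<open>Unlike membership in \<open>solutions\<close>, this does not tie the domain of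
  \<open>\<sigma>\<close> to the instance, so one global assignment can be tested against every
  decimated instance.\<close>

definition satisfies :: "(nat \<Rightarrow> bit) \<Rightarrow> (nat \<rightharpoonup> clause) \<Rightarrow> bool" where
  "satisfies \<sigma> C \<longleftrightarrow> (\<forall>(S, b)\<in>ran C. (\<Sum>x\<in>S. \<sigma> x) = b)"

text \<open>An invariant of decimation; nonemptiness is what provides every clause with a last
  variable.\<close>

definition proper :: "xorsat \<Rightarrow> bool" where
  "proper \<Phi> \<longleftrightarrow> finite (vars \<Phi>) \<and> (\<forall>(S, b)\<in>ran (clauses \<Phi>). S \<noteq> {} \<and> S \<subseteq> vars \<Phi>)"

text \<open>For finite \<open>V\<close> and \<open>t = card V\<close> this is the uniform
  distribution on enumerations of \<open>V\<close>, in the recursive form of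
  \<open>decimate_steps\<close> so that both unfold together.\<close>

primrec random_order :: "nat \<Rightarrow> 'a set \<Rightarrow> 'a list pmf" where
  "random_order 0 V = return_pmf []"
| "random_order (Suc t) V =
     bind_pmf (pmf_of_set V) (\<lambda>x. map_pmf ((#) x) (random_order t (V - {x})))"

lemma UNIV_bit: "(UNIV :: bit set) = {0, 1}"
  by (auto intro: bit.exhaust)

lemma finite_UNIV_bit: "finite (UNIV :: bit set)"
  by (simp add: UNIV_bit)

lemma card_UNIV_bit: "card (UNIV :: bit set) = 2"
  by (simp add: UNIV_bit)

lemma finite_all_clauses: "finite (all_clauses k n)"
  unfolding all_clauses_def by (intro finite_cartesian_product finite_UNIV_bit) simp

lemma last_in_mem: "S \<inter> set xs \<noteq> {} \<Longrightarrow> last_in xs S \<in> S \<inter> set xs"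
proof -
  assume "S \<inter> set xs \<noteq> {}"
  then have "filter (\<lambda>x. x \<in> S) xs \<noteq> []"
    by (auto simp: filter_empty_conv)
  from last_in_set[OF this] show ?thesis
    by (auto simp: last_in_def)
qed

lemma last_in_Cons:
  assumes "S \<inter> set xs \<noteq> {}" "x \<notin> set xs"
  shows "last_in (x # xs) S = last_in xs (S - {x})"
proof -
  have "filter (\<lambda>y. y \<in> S) xs \<noteq> []"
    using assms by (auto simp: filter_empty_conv)
  moreover have "filter (\<lambda>y. y \<in> S - {x}) xs = filter (\<lambda>y. y \<in> S) xs"
    using assms(2) by (intro filter_cong) auto
  ultimately show ?thesis
    by (simp add: last_in_def)
qed

lemma last_in_Cons_singleton: "x \<notin> set xs \<Longrightarrow> last_in (x # xs) {x} = x"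
  by (auto simp: last_in_def filter_empty_conv)

lemma finite_set_random_order: "finite V \<Longrightarrow> card V = t \<Longrightarrow> finite (set_pmf (random_order t V))"
proof (induction t arbitrary: V)
  case (Suc t)
  then have "V \<noteq> {}" by auto
  with Suc show ?case by (auto simp: set_pmf_of_set)
qed auto

lemma set_random_order:
  "finite V \<Longrightarrow> card V = t \<Longrightarrow> xs \<in> set_pmf (random_order t V) \<Longrightarrow> set xs = V \<and> distinct xs"
proof (induction t arbitrary: V xs)
  case (Suc t)
  then have "V \<noteq> {}" by auto
  with Suc.prems obtain x ys where xs: "x \<in> V" "ys \<in> set_pmf (random_order t (V - {x}))" "xs = x # ys"
    by (auto simp: set_pmf_of_set)
  then have "set ys = V - {x} \<and> distinct ys"
    using Suc.prems by (intro Suc.IH) auto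
  with xs show ?case by auto
qed auto

section \<open>Assigning one variable\<close>

lemma ran_assign_var:
  "(S', b') \<in> ran (clauses (assign_var \<Phi> x a)) \<longleftrightarrow>
     (\<exists>S b. (S, b) \<in> ran (clauses \<Phi>) \<and> S' = S - {x} \<and> b' = (if x \<in> S then b + a else b) \<and>
        (x \<in> S \<longrightarrow> S' \<noteq> {}))"
  (is "?L \<longleftrightarrow> ?R")
proof
  assume ?L
  then obtain i where i: "clauses (assign_var \<Phi> x a) i = Some (S', b')"
    by (auto simp: ran_def)
  then obtain S b where S: "clauses \<Phi> i = Some (S, b)"
    by (cases "clauses \<Phi> i") (auto simp: assign_var_def)
  then have "(S, b) \<in> ran (clauses \<Phi>)" by (auto simp: ran_def)
  moreover have "S' = S - {x} \<and> b' = (if x \<in> S then b + a else b) \<and> (x \<in> S \<longrightarrow> S' \<noteq> {})"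
  proof (cases "x \<in> S")
    case True
    with i S show ?thesis
      by (cases "S - {x} = {}") (auto simp: assign_var_def simp del: Diff_eq_empty_iff)
  next
    case False
    with i S show ?thesis by (simp add: assign_var_def)
  qed
  ultimately show ?R by blast
next
  assume ?R
  then obtain S b i where "clauses \<Phi> i = Some (S, b)" "S' = S - {x}"
     "b' = (if x \<in> S then b + a else b)" "x \<in> S \<longrightarrow> S' \<noteq> {}"
    by (auto simp: ran_def)
  then have "clauses (assign_var \<Phi> x a) i = Some (S', b')"
    by (auto simp: assign_var_def)
  then show ?L by (auto simp: ran_def)
qed

lemma proper_assign_var: "proper \<Phi> \<Longrightarrow> proper (assign_var \<Phi> x a)"
proof -
  assume p: "proper \<Phi>"
  have v: "vars (assign_var \<Phi> x a) = vars \<Phi> - {x}" by (simp add: assign_var_def)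
  show ?thesis
    unfolding proper_def v
  proof (intro conjI ballI, goal_cases)
    case 1
    then show ?case using p by (simp add: proper_def)
  next
    case (2 c)
    then obtain S b where "(S, b) \<in> ran (clauses \<Phi>)" "fst c = S - {x}" "x \<in> S \<longrightarrow> fst c \<noteq> {}"
      by (cases c) (auto simp only: ran_assign_var fst_conv)
    with p show ?case by (cases c) (fastforce simp: proper_def)
  qed
qed

text \<open>Over GF(2), moving \<open>\<sigma> x\<close> to the other side of an equation means
  adding it to the right-hand side. Hence a solution survives every step that agrees with
  it.\<close>

lemma satisfies_assign_var:
  assumes "proper \<Phi>" "satisfies \<sigma> (clauses \<Phi>)"
  shows "satisfies \<sigma> (clauses (assign_var \<Phi> x (\<sigma> x)))"
proof -
  have eq: "sum \<sigma> (S - {x}) = (if x \<in> S then b + \<sigma> x else b)" if "(S, b) \<in> ran (clauses \<Phi>)" for S b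
  proof -
    have "finite S" "sum \<sigma> S = b"
      using that assms by (auto 0 3 simp: proper_def satisfies_def dest!: bspec dest: finite_subset)
    then show ?thesis
      by (auto simp: sum.remove[of S x] add.commute add.left_commute)
  qed
  show ?thesis
    unfolding satisfies_def
  proof (intro ballI, clarify)
    fix S' b' assume "(S', b') \<in> ran (clauses (assign_var \<Phi> x (\<sigma> x)))"
    with eq show "sum \<sigma> S' = b'" unfolding ran_assign_var by blast
  qed
qed

text \<open>A removed variable is never selected again, so its value is final.\<close>

lemma set_decimate_steps:
  "\<sigma>' \<in> set_pmf (decimate_steps R \<tau> t \<Phi> \<sigma>) \<Longrightarrow> finite (vars \<Phi>) \<Longrightarrow> card (vars \<Phi>) = t \<Longrightarrow>
    x \<notin> vars \<Phi> \<Longrightarrow> \<sigma>' x = \<sigma> x"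
proof (induction t arbitrary: \<Phi> \<sigma>)
  case (Suc t)
  then have "vars \<Phi> \<noteq> {}" by auto
  with Suc.prems obtain y a where y: "y \<in> vars \<Phi>"
     "\<sigma>' \<in> set_pmf (decimate_steps R \<tau> t (assign_var \<Phi> y a) (\<sigma>(y := a)))"
    by (auto simp: set_pmf_of_set)
  have "\<sigma>' x = (\<sigma>(y := a)) x"
    using Suc.prems y by (intro Suc.IH[OF y(2)]) (auto simp: assign_var_def)
  with y Suc.prems show ?case by auto
qed auto

section \<open>Locality of the unit clause rule\<close>

lemma fdist_common_clause:
  assumes "clauses \<Phi> i = Some (S, b)" "x \<in> S" "y \<in> S" "S \<subseteq> vars \<Phi>"
  shows "fdist \<Phi> (VarNode x) (VarNode y) \<le> enat 2"
proof -
  have "(VarNode x, ClauseNode i) \<in> factor_graph \<Phi>" "(ClauseNode i, VarNode y) \<in> factor_graph \<Phi>"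
    using assms by (auto simp: factor_graph_def Let_def)
  then have "(VarNode x, VarNode y) \<in> factor_graph \<Phi> ^^ 2"
    by (auto simp: numeral_2_eq_2)
  then show ?thesis
    unfolding fdist_def by (intro INF_lower) auto
qed

text \<open>Cutting clauses down to the ball might create unit clauses that the instance does not
  have. Radius 2 excludes this on \<open>x\<close>: a clause containing \<open>x\<close> has all its
  variables within distance 2.\<close>

lemma UC_eq_half:
  assumes "proper \<Phi>" "\<nexists>b. ({x}, b) \<in> ran (clauses \<Phi>)"
  shows "UC (neighbourhood \<Phi> x 2) = 1 / 2"
proof -
  have no_unit: False if "clauses (fst (neighbourhood \<Phi> x 2)) i = Some ({x}, b)" for i b
  proof -
    define V where "V = {y \<in> vars \<Phi>. fdist \<Phi> (VarNode x) (VarNode y) \<le> enat 2}"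
    have nb: "(case clauses \<Phi> i of None \<Rightarrow> None | Some (S, b) \<Rightarrow>
        if fdist \<Phi> (VarNode x) (ClauseNode i) \<le> enat 2 then Some (S \<inter> V, b) else None) = Some ({x}, b)"
      using that unfolding V_def by (simp add: neighbourhood_def Let_def)
    obtain S where S: "clauses \<Phi> i = Some (S, b)" "S \<inter> V = {x}"
    proof (cases "clauses \<Phi> i")
      case (Some p)
      then show ?thesis using nb that[of "fst p"] by (cases p) (simp split: if_splits)
    qed (use nb in simp)
    then have sub: "S \<subseteq> vars \<Phi>"
      using assms(1) by (auto simp: proper_def ran_def)
    have "S \<subseteq> V"
      using fdist_common_clause[OF S(1) _ _ sub, of x] S(2) sub by (auto simp: V_def)
    with S have "S = {x}" by auto
    with S(1) assms(2) show False by (auto simp: ran_def)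
  qed
  obtain \<Psi> where \<Psi>: "neighbourhood \<Phi> x 2 = (\<Psi>, x)"
    by (simp add: neighbourhood_def Let_def)
  have "\<nexists>i b. clauses \<Psi> i = Some ({x}, b)"
    using no_unit by (auto simp: \<Psi>)
  then show ?thesis
    by (simp add: UC_def \<Psi>)
qed

section \<open>The probability of a given output\<close>

lemma pmf_bernoulli_half_bit: "pmf (map_pmf of_bool (bernoulli_pmf (1 / 2))) (a :: bit) = 1 / 2"
proof -
  have "inj (of_bool :: bool \<Rightarrow> bit)" by (auto intro: injI)
  from pmf_map_inj'[OF this, of "bernoulli_pmf (1/2)" "a = 1"] show ?thesis
    by (cases a) auto
qed

text \<open>A surviving clause keeps its last variable, which differs from \<open>x\<close>. A unit
  clause on \<open>x\<close> has last variable \<open>x\<close> and disappears, which accounts for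
  the extra one.\<close>

lemma card_lasts_assign_var:
  assumes "proper \<Phi>" "set (x # xs) = vars \<Phi>" "x \<notin> set xs"
  shows "card (lasts (last_in xs) (clauses (assign_var \<Phi> x a))) + of_bool (\<exists>b. ({x}, b) \<in> ran (clauses \<Phi>))
           \<le> card (lasts (last_in (x # xs)) (clauses \<Phi>))"
proof -
  let ?A = "lasts (last_in xs) (clauses (assign_var \<Phi> x a))"
  let ?B = "lasts (last_in (x # xs)) (clauses \<Phi>)"
  have A: "last_in xs S' \<in> ?B - {x}" if "(S', b') \<in> ran (clauses (assign_var \<Phi> x a))" for S' b'
  proof -
    from that obtain S b where S: "(S, b) \<in> ran (clauses \<Phi>)" "S' = S - {x}" "x \<in> S \<longrightarrow> S' \<noteq> {}"
      by (auto simp: ran_assign_var)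
    have "S \<noteq> {}" "S \<subseteq> insert x (set xs)"
      using S(1) assms(1,2) by (auto simp: proper_def)
    then have ne: "S' \<inter> set xs \<noteq> {}" "S \<inter> set xs \<noteq> {}" using S by auto
    have "last_in xs S' = last_in (x # xs) S"
      using last_in_Cons[OF ne(2) assms(3)] S(2) by simp
    moreover have "last_in xs S' \<noteq> x"
      using last_in_mem[OF ne(1)] assms(3) by auto
    ultimately show ?thesis
      using S(1) by (force simp: lasts_def)
  qed
  then have sub: "?A \<subseteq> ?B - {x}" by (auto simp: lasts_def)
  have "last_in (x # xs) S \<in> vars \<Phi>" if "(S, b) \<in> ran (clauses \<Phi>)" for S b
  proof -
    have "S \<inter> set (x # xs) \<noteq> {}" using that assms(1) unfolding assms(2) proper_def by fast
    from last_in_mem[OF this] assms(2) show ?thesis by auto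
  qed
  then have "?B \<subseteq> vars \<Phi>" by (auto simp: lasts_def)
  then have fin: "finite ?B" using assms(1) by (auto simp: proper_def intro: finite_subset)
  show ?thesis
  proof (cases "\<exists>b. ({x}, b) \<in> ran (clauses \<Phi>)")
    case True
    then have "x \<in> ?B"
      using last_in_Cons_singleton[OF assms(3)] by (force simp: lasts_def)
    then have "card ?B = Suc (card (?B - {x}))" using fin by (rule card.remove[rotated])
    with True card_mono[OF _ sub] fin show ?thesis by auto
  next
    case False
    have "card ?A \<le> card ?B" using sub fin by (intro card_mono) auto
    with False show ?thesis by auto
  qed
qed

text \<open>A free step agrees with \<open>\<sigma>\<close> with probability 1/2. A forced step is
  bounded by 1, and the lost factor 1/2 is offset by one more element of \<open>lasts\<close>. The
  partial assignment \<open>\<sigma>\<^sub>0\<close> is arbitrary so that the induction can carry it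
  along.\<close>

lemma pmf_decimate_steps_le:
  "proper \<Phi> \<Longrightarrow> satisfies \<sigma> (clauses \<Phi>) \<Longrightarrow> card (vars \<Phi>) = t \<Longrightarrow>
   ennreal (pmf (decimate_steps 2 UC t \<Phi> \<sigma>\<^sub>0) \<sigma>) \<le>
     (\<integral>\<^sup>+xs. ennreal ((1/2) ^ t * 2 ^ card (lasts (last_in xs) (clauses \<Phi>))) \<partial>random_order t (vars \<Phi>))"
proof (induction t arbitrary: \<Phi> \<sigma>\<^sub>0)
  case 0
  have "ennreal (pmf (decimate_steps 2 UC 0 \<Phi> \<sigma>\<^sub>0) \<sigma>) \<le> ennreal 1"
    by (intro ennreal_leI pmf_le_1)
  also have "\<dots> \<le> ennreal (2 ^ card (lasts (last_in []) (clauses \<Phi>)))"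
    by (intro ennreal_leI) simp
  finally show ?case by simp
next
  case (Suc t)
  let ?V = "vars \<Phi>"
  let ?W = "\<lambda>\<Phi> xs. 2 ^ card (lasts (last_in xs) (clauses \<Phi>)) :: real"
  have V: "finite ?V" "?V \<noteq> {}" using Suc.prems by (auto simp: proper_def)
  define M :: "nat \<Rightarrow> bit pmf" where "M x = map_pmf of_bool (bernoulli_pmf (UC (neighbourhood \<Phi> x 2)))" for x
  have step: "(\<integral>\<^sup>+a. ennreal (pmf (decimate_steps 2 UC t (assign_var \<Phi> x a) (\<sigma>\<^sub>0(x := a))) \<sigma>) \<partial>M x)
     \<le> (\<integral>\<^sup>+xs. ennreal ((1/2) ^ Suc t * ?W \<Phi> (x # xs)) \<partial>random_order t (?V - {x}))"
    if x: "x \<in> ?V" for x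
  proof -
    define \<Phi>' where "\<Phi>' = assign_var \<Phi> x (\<sigma> x)"
    have vars': "vars (assign_var \<Phi> x a) = ?V - {x}" for a by (simp add: assign_var_def)
    have card': "card (?V - {x}) = t" using Suc.prems x by auto
    define c where "c = (\<integral>\<^sup>+xs. ennreal ((1/2) ^ t * ?W \<Phi>' xs) \<partial>random_order t (?V - {x}))"
    \<comment> \<open>A choice other than \<open>\<sigma> x\<close> is never revised and excludes
      the output \<open>\<sigma>\<close>, so only one branch contributes.\<close>
    have "(\<integral>\<^sup>+a. ennreal (pmf (decimate_steps 2 UC t (assign_var \<Phi> x a) (\<sigma>\<^sub>0(x := a))) \<sigma>) \<partial>M x)
       \<le> (\<integral>\<^sup>+a. c * indicator {\<sigma> x} a \<partial>M x)"
    proof (intro nn_integral_mono)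
      fix a :: bit
      show "ennreal (pmf (decimate_steps 2 UC t (assign_var \<Phi> x a) (\<sigma>\<^sub>0(x := a))) \<sigma>)
              \<le> c * indicator {\<sigma> x} a"
      proof (cases "a = \<sigma> x")
        case True
        have "ennreal (pmf (decimate_steps 2 UC t \<Phi>' (\<sigma>\<^sub>0(x := a))) \<sigma>)
           \<le> (\<integral>\<^sup>+xs. ennreal ((1/2) ^ t * ?W \<Phi>' xs) \<partial>random_order t (vars \<Phi>'))"
          unfolding \<Phi>'_def using Suc.prems card'
          by (intro Suc.IH proper_assign_var satisfies_assign_var) (auto simp: vars')
        with True show ?thesis by (simp add: \<Phi>'_def vars' c_def)
      next
        case False
        have "\<sigma> \<notin> set_pmf (decimate_steps 2 UC t (assign_var \<Phi> x a) (\<sigma>\<^sub>0(x := a)))"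
        proof
          assume "\<sigma> \<in> set_pmf (decimate_steps 2 UC t (assign_var \<Phi> x a) (\<sigma>\<^sub>0(x := a)))"
          from set_decimate_steps[OF this, of x] have "\<sigma> x = a"
            using V(1) card' by (auto simp: vars')
          with False show False by simp
        qed
        then show ?thesis by (simp add: set_pmf_iff)
      qed
    qed
    also have "\<dots> = c * ennreal (pmf (M x) (\<sigma> x))"
      by (simp add: nn_integral_cmult_indicator emeasure_pmf_single)
    also have "\<dots> = (\<integral>\<^sup>+xs. ennreal ((1/2) ^ t * ?W \<Phi>' xs * pmf (M x) (\<sigma> x)) \<partial>random_order t (?V - {x}))"
      unfolding c_def by (subst nn_integral_multc[symmetric]) (auto simp: ennreal_mult)
    also have "\<dots> \<le> (\<integral>\<^sup>+xs. ennreal ((1/2) ^ Suc t * ?W \<Phi> (x # xs)) \<partial>random_order t (?V - {x}))"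
    proof (intro nn_integral_mono_AE, unfold AE_measure_pmf_iff, intro ballI ennreal_leI)
      fix xs assume "xs \<in> set_pmf (random_order t (?V - {x}))"
      from set_random_order[OF _ card' this] have xs: "set xs = ?V - {x}" using V by auto
      let ?u = "\<exists>b. ({x}, b) \<in> ran (clauses \<Phi>)"
      have "card (lasts (last_in xs) (clauses \<Phi>')) + of_bool ?u
           \<le> card (lasts (last_in (x # xs)) (clauses \<Phi>))"
        unfolding \<Phi>'_def using Suc.prems xs x by (intro card_lasts_assign_var) auto
      then have "2 ^ (card (lasts (last_in xs) (clauses \<Phi>')) + of_bool ?u) \<le> ?W \<Phi> (x # xs)"
        by (intro power_increasing) auto
      then have le: "?W \<Phi>' xs * 2 ^ of_bool ?u \<le> ?W \<Phi> (x # xs)" by (simp add: power_add)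
      \<comment> \<open>The right side is 1 for a forced variable and 1/2 for a free one; its power
        of 2 is the gain recorded in \<open>le\<close>.\<close>
      have "pmf (M x) (\<sigma> x) \<le> 2 ^ of_bool ?u / 2"
      proof (cases ?u)
        case True
        then show ?thesis by (simp add: pmf_le_1)
      next
        case False
        then show ?thesis
          unfolding M_def UC_eq_half[OF Suc.prems(1) False] pmf_bernoulli_half_bit by simp
      qed
      then have "?W \<Phi>' xs * pmf (M x) (\<sigma> x) \<le> ?W \<Phi>' xs * (2 ^ of_bool ?u / 2)"
        by (intro mult_left_mono) auto
      also have "\<dots> \<le> ?W \<Phi> (x # xs) / 2" using le by simp
      finally have "(1/2) ^ t * (?W \<Phi>' xs * pmf (M x) (\<sigma> x)) \<le> (1/2) ^ t * (?W \<Phi> (x # xs) / 2)"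
        by (intro mult_left_mono) auto
      then show "(1/2) ^ t * ?W \<Phi>' xs * pmf (M x) (\<sigma> x) \<le> (1/2) ^ Suc t * ?W \<Phi> (x # xs)"
        by (simp add: mult.assoc)
    qed
    finally show ?thesis .
  qed
  have "ennreal (pmf (decimate_steps 2 UC (Suc t) \<Phi> \<sigma>\<^sub>0) \<sigma>) =
     (\<integral>\<^sup>+x. (\<integral>\<^sup>+a. ennreal (pmf (decimate_steps 2 UC t (assign_var \<Phi> x a) (\<sigma>\<^sub>0(x := a))) \<sigma>) \<partial>M x)
        \<partial>pmf_of_set ?V)"
    by (simp add: ennreal_pmf_bind M_def)
  also have "\<dots> \<le> (\<integral>\<^sup>+x. (\<integral>\<^sup>+xs. ennreal ((1/2) ^ Suc t * ?W \<Phi> (x # xs)) \<partial>random_order t (?V - {x}))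
        \<partial>pmf_of_set ?V)"
    using step V by (intro nn_integral_mono_AE) (auto simp: AE_measure_pmf_iff)
  also have "\<dots> = (\<integral>\<^sup>+xs. ennreal ((1/2) ^ Suc t * ?W \<Phi> xs) \<partial>random_order (Suc t) ?V)"
    by simp
  finally show ?case .
qed


section \<open>Coincidences among last variables\<close>

lemma lasts_upd: "C i = None \<Longrightarrow> lasts L (C(i \<mapsto> (S, b))) = insert (L S) (lasts L C)"
  by (simp add: lasts_def)

lemma satisfies_upd:
  "C i = None \<Longrightarrow> satisfies \<sigma> (C(i \<mapsto> (S, b))) \<longleftrightarrow> (\<Sum>x\<in>S. \<sigma> x) = b \<and> satisfies \<sigma> C"
  by (simp add: satisfies_def)

text \<open>
  The function \<open>B\<close> bounds the mean of \<open>2 ^ card (A \<union> lasts)\<close> over satisfied right-hand sides when \<open>j\<close>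
  clauses remain and \<open>c\<close> last variables have been seen. The factor \<open>2\<close> on the right is the
  reciprocal of the probability that the next right-hand side is the satisfied one.
\<close>

lemma sum_new_last_le:
  fixes q \<delta> :: real and L :: "nat set \<Rightarrow> nat" and A :: "nat set" and j d k n :: nat
  defines "T \<equiv> {S. S \<subseteq> {1..n} \<and> card S = k}"
  defines "B \<equiv> \<lambda>j c. 2 ^ c * q ^ j / q ^ (d - c)"
  assumes q: "q = 1 - \<delta> / 2" "0 \<le> \<delta>" "\<delta> \<le> 1"
    and \<delta>: "\<delta> * real (n choose k) \<le> real (d choose k)"
    and L: "\<And>S. S \<in> T \<Longrightarrow> L S \<in> S" and A: "A \<subseteq> {1..n}"
  shows "(\<Sum>S\<in>T. B j (card (insert (L S) A))) \<le> 2 * real (card T) * B (Suc j) (card A)"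
proof -
  have fin: "finite T" "finite A"
    unfolding T_def using A by (auto intro: finite_subset)
  have cT: "card T = n choose k"
    unfolding T_def using n_subsets[of "{1..n}" k] by simp
  have q0: "q > 0" "q \<ge> 1/2" "q \<le> 1" using q by auto
  define c where "c = card A"
  show ?thesis
  proof (cases "c < d")
    case True
    \<comment> \<open>Below \<open>d\<close> repetitions are not guaranteed. A new last variable
      lowers \<open>d - c\<close> by one, which pays exactly for the factor \<open>q\<close> in
      \<open>B (Suc j) c\<close>; a repeated one is covered by \<open>2 * q \<ge> 1\<close>.\<close>
    then have d: "d - c = Suc (d - Suc c)" by simp
    have "B j (card (insert (L S) A)) \<le> 2 * B (Suc j) c" for S
    proof (cases "L S \<in> A")
      case True
      have "B j c * 1 \<le> B j c * (2 * q)"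
        using q0 by (intro mult_left_mono) (auto simp: B_def)
      with True show ?thesis by (simp add: insert_absorb c_def B_def mult_ac)
    next
      case False
      then have "B j (card (insert (L S) A)) = B j (Suc c)"
        using fin by (simp add: c_def)
      also have "\<dots> = 2 * B (Suc j) c"
        using q0 by (simp add: B_def d)
      finally show ?thesis by simp
    qed
    then have "(\<Sum>S\<in>T. B j (card (insert (L S) A))) \<le> (\<Sum>S\<in>T. 2 * B (Suc j) c)"
      by (intro sum_mono)
    then show ?thesis by (simp add: c_def)
  next
    case False
    define U where "U = {S. S \<subseteq> A \<and> card S = k}"
    \<comment> \<open>A clause inside \<open>A\<close> has its last variable in \<open>A\<close>, whatever the order.\<close>
    have U: "U \<subseteq> {S \<in> T. L S \<in> A}" using A L by (auto simp: U_def T_def)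
    have UT: "U \<subseteq> T" using U by auto
    have cU: "card U = c choose k"
      using n_subsets[OF fin(2), of k] by (simp add: U_def c_def)
    have "\<delta> * real (card T) \<le> real (card U)"
    proof -
      have "d choose k \<le> c choose k" using False by (intro binomial_right_mono) auto
      then show ?thesis using \<delta> by (simp add: cT cU)
    qed
    \<comment> \<open>From \<open>d\<close> on, \<open>d - c\<close> is 0. A clause in
      \<open>U\<close> contributes a factor 1 and any other at most 2, so the mean factor is at most
      \<open>2 - \<delta> = 2 * q\<close>. This dictates the choice of \<open>q\<close>.\<close>
    then have count: "real (card U) + 2 * (real (card T) - real (card U)) \<le> 2 * real (card T) * q"
      by (simp add: q algebra_simps)
    have "(\<Sum>S\<in>T. B j (card (insert (L S) A))) \<le> (\<Sum>S\<in>T. 2 ^ c * q ^ j * (if S \<in> U then 1 else 2))"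
    proof (intro sum_mono)
      fix S assume "S \<in> T"
      show "B j (card (insert (L S) A)) \<le> 2 ^ c * q ^ j * (if S \<in> U then 1 else 2)"
        using U False fin q0 by (auto simp: B_def c_def insert_absorb card_insert_if)
    qed
    also have "\<dots> = 2 ^ c * q ^ j * (\<Sum>S\<in>T. if S \<in> U then 1 else 2)"
      by (simp only: sum_distrib_left)
    also have "(\<Sum>S\<in>T. if S \<in> U then 1 else 2) = real (card U) + 2 * (real (card T) - real (card U))"
      using fin UT by (simp add: sum.If_cases Int_absorb1 card_Diff_subset finite_subset of_nat_diff card_mono
          flip: Diff_eq)
    also have "2 ^ c * q ^ j * \<dots> \<le> 2 ^ c * q ^ j * (2 * real (card T) * q)"
      using count q0 by (intro mult_left_mono) auto
    finally show ?thesis using False by (simp add: B_def c_def mult_ac)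
  qed
qed

text \<open>The clauses are revealed one at a time, with \<open>A\<close> collecting the last
  variables already seen; each revelation is one application of
  \<open>sum_new_last_le\<close>.\<close>

lemma nn_integral_satisfies_lasts_le:
  fixes q \<delta> :: real and L :: "nat set \<Rightarrow> nat" and d k n :: nat and \<sigma> :: "nat \<Rightarrow> bit"
  assumes q: "q = 1 - \<delta> / 2" "0 \<le> \<delta>" "\<delta> \<le> 1"
    and \<delta>: "\<delta> * real (n choose k) \<le> real (d choose k)"
    and L: "\<And>S. S \<subseteq> {1..n} \<Longrightarrow> card S = k \<Longrightarrow> L S \<in> S" and kn: "k \<le> n"
    and J: "finite J" and A: "A \<subseteq> {1..n}"
  shows "(\<integral>\<^sup>+C. ennreal (of_bool (satisfies \<sigma> C) * 2 ^ card (A \<union> lasts L C))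
           \<partial>Pi_pmf J None (\<lambda>_. map_pmf Some (pmf_of_set (all_clauses k n))))
         \<le> ennreal (2 ^ card A * q ^ card J / q ^ (d - card A))"
  using J A
proof (induction J arbitrary: A rule: finite_induct)
  case empty
  have q0: "q > 0" "q \<le> 1" using q by auto
  \<comment> \<open>If fewer than \<open>d\<close> last variables occur, the remaining power of
    \<open>q\<close> in the denominator only weakens the bound.\<close>
  have "1 \<le> 1 / q ^ (d - card A)" using q0 by (simp add: power_le_one)
  then have "2 ^ card A * 1 \<le> 2 ^ card A * (1 / q ^ (d - card A))" by (intro mult_left_mono) auto
  then show ?case by (simp add: satisfies_def lasts_def ennreal_leI)
next
  case (insert i J)
  define T where "T = {S. S \<subseteq> {1..n} \<and> card S = k}"
  let ?P = "Pi_pmf J None (\<lambda>_. map_pmf Some (pmf_of_set (all_clauses k n)))"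
  let ?w = "\<lambda>A C. of_bool (satisfies \<sigma> C) * 2 ^ card (A \<union> lasts L C) :: real"
  let ?B = "\<lambda>j c. 2 ^ c * q ^ j / q ^ (d - c)"
  have q0: "q > 0" using q by auto
  have cT: "card T = n choose k"
    unfolding T_def using n_subsets[of "{1..n}" k] by simp
  have fT: "finite T" by (simp add: T_def)
  have cT0: "card T > 0" using kn by (simp add: cT)
  then have T0: "T \<noteq> {}" by auto
  have all: "all_clauses k n = T \<times> UNIV" by (simp add: all_clauses_def T_def)
  have step: "(\<integral>\<^sup>+C. ennreal (?w A (C(i \<mapsto> (S, b)))) \<partial>?P)
     \<le> ennreal (of_bool ((\<Sum>x\<in>S. \<sigma> x) = b) * ?B (card J) (card (insert (L S) A)))" if S: "S \<in> T" for S b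
  proof -
    have "(\<integral>\<^sup>+C. ennreal (?w A (C(i \<mapsto> (S, b)))) \<partial>?P)
       = (\<integral>\<^sup>+C. ennreal (of_bool ((\<Sum>x\<in>S. \<sigma> x) = b)) * ennreal (?w (insert (L S) A) C) \<partial>?P)"
    proof (intro nn_integral_cong_AE, unfold AE_measure_pmf_iff, intro ballI)
      fix C assume "C \<in> set_pmf ?P"
      \<comment> \<open>Outside \<open>J\<close> the product takes its default \<open>None\<close>,
        so the update adds a clause and overwrites nothing.\<close>
      then have "C i = None"
        using insert.hyps by (auto simp: set_Pi_pmf PiE_dflt_def)
      then show "ennreal (?w A (C(i \<mapsto> (S, b)))) =
          ennreal (of_bool ((\<Sum>x\<in>S. \<sigma> x) = b)) * ennreal (?w (insert (L S) A) C)"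
        by (auto simp: lasts_upd satisfies_upd)
    qed
    also have "\<dots> = ennreal (of_bool ((\<Sum>x\<in>S. \<sigma> x) = b)) * (\<integral>\<^sup>+C. ennreal (?w (insert (L S) A) C) \<partial>?P)"
      by (simp add: nn_integral_cmult)
    also have "\<dots> \<le> ennreal (of_bool ((\<Sum>x\<in>S. \<sigma> x) = b)) * ennreal (?B (card J) (card (insert (L S) A)))"
    proof (intro mult_left_mono insert.IH)
      show "insert (L S) A \<subseteq> {1..n}"
        using S L[of S] insert.prems by (auto simp: T_def)
    qed simp
    finally show ?thesis using q0 by (subst ennreal_mult) auto
  qed
  have "(\<integral>\<^sup>+C. ennreal (?w A C) \<partial>Pi_pmf (insert i J) None (\<lambda>_. map_pmf Some (pmf_of_set (all_clauses k n))))
     = (\<integral>\<^sup>+Sb. (\<integral>\<^sup>+C. ennreal (?w A (C(i \<mapsto> Sb))) \<partial>?P) \<partial>pmf_of_set (T \<times> UNIV))"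
    by (simp only: Pi_pmf_insert'[OF insert.hyps] all bind_map_pmf nn_integral_bind_pmf) simp
  also have "\<dots> \<le> (\<integral>\<^sup>+Sb. ennreal (case Sb of (S, b) \<Rightarrow> of_bool ((\<Sum>x\<in>S. \<sigma> x) = b) * ?B (card J) (card (insert (L S) A)))
        \<partial>pmf_of_set (T \<times> UNIV))"
    using step T0 fT
    by (intro nn_integral_mono_AE)
       (auto simp: AE_measure_pmf_iff set_pmf_of_set finite_cartesian_product finite_UNIV_bit)
  also have "\<dots> = ennreal ((\<Sum>Sb\<in>T \<times> UNIV. case Sb of (S, b) \<Rightarrow> of_bool ((\<Sum>x\<in>S. \<sigma> x) = b) * ?B (card J) (card (insert (L S) A)))
       / (2 * real (card T)))"
  proof -
    have nonneg: "0 \<le> (case Sb of (S, b) \<Rightarrow> of_bool ((\<Sum>x\<in>S. \<sigma> x) = b) * ?B (card J) (card (insert (L S) A)))" for Sb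
      using q0 by (cases Sb) simp
    have "card (T \<times> (UNIV :: bit set)) = 2 * card T"
      by (simp add: card_cartesian_product card_UNIV_bit)
    moreover have "finite (T \<times> (UNIV :: bit set))" "T \<times> (UNIV :: bit set) \<noteq> {}"
      using fT T0 finite_UNIV_bit by auto
    ultimately show ?thesis
      using cT0 nonneg
      by (subst nn_integral_pmf_of_set)
         (simp_all add: sum_ennreal divide_ennreal sum_nonneg ennreal_of_nat_eq_real_of_nat del: times_divide_eq_right)
  qed
  also have "(\<Sum>Sb\<in>T \<times> UNIV. case Sb of (S, b) \<Rightarrow> of_bool ((\<Sum>x\<in>S. \<sigma> x) = b) * ?B (card J) (card (insert (L S) A)))
     = (\<Sum>S\<in>T. ?B (card J) (card (insert (L S) A)))"
  proof (subst sum.cartesian_product[symmetric], intro sum.cong refl)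
    fix S
    \<comment> \<open>Exactly one of the two right-hand sides agrees with
      \<open>\<sigma>\<close>.\<close>
    have "(\<Sum>b\<in>UNIV. of_bool ((\<Sum>x\<in>S. \<sigma> x) = b)) = (1 :: real)"
      by (simp add: finite_UNIV_bit of_bool_def)
    then show "(\<Sum>b\<in>UNIV. of_bool ((\<Sum>x\<in>S. \<sigma> x) = b) * ?B (card J) (card (insert (L S) A))) =
        ?B (card J) (card (insert (L S) A))"
      by (simp only: sum_distrib_right[symmetric] mult_1)
  qed
  also have "ennreal (\<dots> / (2 * real (card T))) \<le> ennreal (?B (Suc (card J)) (card A))"
  proof (intro ennreal_leI)
    have "(\<Sum>S\<in>T. ?B (card J) (card (insert (L S) A))) \<le> 2 * real (card T) * ?B (Suc (card J)) (card A)"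
      unfolding T_def using L insert.prems by (intro sum_new_last_le[OF q \<delta>]) auto
    then show "(\<Sum>S\<in>T. ?B (card J) (card (insert (L S) A))) / (2 * real (card T)) \<le> ?B (Suc (card J)) (card A)"
      using cT0 by (simp add: divide_le_eq mult_ac)
  qed
  finally show ?case using insert.hyps by simp
qed


section \<open>Failure of unit clause decimation\<close>

text \<open>The order is independent of the clauses, so for each fixed \<open>\<sigma>\<close> and
  order the mean over clauses is taken first. The \<open>2 ^ n\<close> assignments then cancel the
  factor \<open>(1/2) ^ n\<close>.\<close>

lemma prob_DEC_UC_solves_le:
  fixes q \<delta> :: real and d k n m :: nat
  assumes q: "q = 1 - \<delta> / 2" "0 \<le> \<delta>" "\<delta> \<le> 1"
    and \<delta>: "\<delta> * real (n choose k) \<le> real (d choose k)"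
    and k: "1 \<le> k" "k \<le> n"
  shows "measure_pmf.prob
            (bind_pmf (random_xorsat k n m) (\<lambda>\<Phi>. map_pmf (\<lambda>\<sigma>. (\<Phi>, \<sigma>)) (DEC_UC \<Phi>)))
            {(\<Phi>, \<sigma>). \<sigma> \<in> solutions \<Phi>} \<le> q ^ m / q ^ d"
proof -
  define P where "P = Pi_pmf {1..m} None (\<lambda>_. map_pmf Some (pmf_of_set (all_clauses k n)))"
  define \<Phi> where "\<Phi> C = \<lparr>vars = {1..n}, clauses = C\<rparr>" for C :: "nat \<rightharpoonup> clause"
  define F :: "(nat \<Rightarrow> bit) set" where "F = {1..n} \<rightarrow>\<^sub>E UNIV"
  define Q where "Q = random_order n {1..n}"
  let ?w = "\<lambda>\<sigma> xs C. of_bool (satisfies \<sigma> C) * 2 ^ card (lasts (last_in xs) C) :: real"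
  have q0: "q > 0" using q by auto
  have F: "finite F" "card F = 2 ^ n"
    by (auto simp: F_def card_UNIV_bit card_funcsetE intro!: finite_PiE finite_UNIV_bit)
  have Q: "finite (set_pmf Q)"
    by (auto simp: Q_def intro: finite_set_random_order)
  have sol: "\<sigma> \<in> solutions (\<Phi> C) \<longleftrightarrow> \<sigma> \<in> F \<and> satisfies \<sigma> C" for \<sigma> C
    by (auto simp: solutions_def \<Phi>_def F_def satisfies_def ran_def)
  \<comment> \<open>The support of \<open>pmf_of_set\<close> is known only for a nonempty set, hence
    the use of \<open>k \<le> n\<close>.\<close>
  have "({1..k}, 0) \<in> all_clauses k n"
    using k by (auto simp: all_clauses_def)
  then have "all_clauses k n \<noteq> {}" by auto
  then have supp: "set_pmf (pmf_of_set (all_clauses k n)) = all_clauses k n"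
    by (intro set_pmf_of_set finite_all_clauses)
  have set_P: "ran C \<subseteq> all_clauses k n" if "C \<in> set_pmf P" for C
  proof
    fix c assume "c \<in> ran C"
    then obtain i where i: "C i = Some c" by (auto simp: ran_def)
    have C: "C \<in> PiE_dflt {1..m} None (\<lambda>_. Some ` all_clauses k n)"
      using that by (simp add: P_def set_Pi_pmf comp_def supp)
    then have "i \<in> {1..m}" using i by (cases "i \<in> {1..m}") (auto simp: PiE_dflt_def)
    with C i show "c \<in> all_clauses k n" by (force simp: PiE_dflt_def)
  qed
  have proper: "proper (\<Phi> C)" if "C \<in> set_pmf P" for C
    unfolding proper_def
  proof (intro conjI ballI, goal_cases)
    case (2 c)
    then have "c \<in> all_clauses k n" using set_P[OF that] by (auto simp: \<Phi>_def)
    then show ?case using k by (auto simp: all_clauses_def \<Phi>_def)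
  qed (simp add: \<Phi>_def)
  have solve: "emeasure (DEC_UC (\<Phi> C)) (solutions (\<Phi> C)) \<le>
      (\<Sum>\<sigma>\<in>F. \<Sum>xs\<in>set_pmf Q. ennreal ((1/2) ^ n * pmf Q xs) * ennreal (?w \<sigma> xs C))" if C: "C \<in> set_pmf P" for C
  proof -
    have sub: "solutions (\<Phi> C) = {\<sigma>\<in>F. satisfies \<sigma> C}" using sol by auto
    have "emeasure (DEC_UC (\<Phi> C)) (solutions (\<Phi> C)) =
        (\<Sum>\<sigma>\<in>{\<sigma>\<in>F. satisfies \<sigma> C}. ennreal (pmf (DEC_UC (\<Phi> C)) \<sigma>))"
      unfolding sub using F by (subst emeasure_measure_pmf_finite) (auto simp: sum_ennreal)
    also have "\<dots> \<le> (\<Sum>\<sigma>\<in>{\<sigma>\<in>F. satisfies \<sigma> C}.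
        \<Sum>xs\<in>set_pmf Q. ennreal ((1/2) ^ n * pmf Q xs) * ennreal (?w \<sigma> xs C))"
    proof (intro sum_mono)
      fix \<sigma> assume \<sigma>: "\<sigma> \<in> {\<sigma>\<in>F. satisfies \<sigma> C}"
      have "ennreal (pmf (decimate_steps 2 UC n (\<Phi> C) (\<lambda>_. undefined)) \<sigma>) \<le>
         (\<integral>\<^sup>+xs. ennreal ((1/2) ^ n * 2 ^ card (lasts (last_in xs) (clauses (\<Phi> C)))) \<partial>random_order n (vars (\<Phi> C)))"
        using proper[OF C] \<sigma> by (intro pmf_decimate_steps_le) (auto simp: \<Phi>_def)
      also have "\<dots> = (\<integral>\<^sup>+xs. ennreal ((1/2) ^ n * ?w \<sigma> xs C) \<partial>Q)"
        using \<sigma> by (simp add: \<Phi>_def Q_def)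
      also have "\<dots> = (\<Sum>xs\<in>set_pmf Q. ennreal ((1/2) ^ n * pmf Q xs) * ennreal (?w \<sigma> xs C))"
        using Q by (subst nn_integral_measure_pmf_finite)
          (auto simp: mult_ac simp flip: ennreal_mult intro!: sum.cong)
      finally show "ennreal (pmf (DEC_UC (\<Phi> C)) \<sigma>) \<le>
          (\<Sum>xs\<in>set_pmf Q. ennreal ((1/2) ^ n * pmf Q xs) * ennreal (?w \<sigma> xs C))"
        by (simp add: DEC_UC_def decimation_def \<Phi>_def)
    qed
    \<comment> \<open>The index set must not depend on \<open>C\<close>, so that sum and integral
      can be exchanged.\<close>
    also have "\<dots> \<le> (\<Sum>\<sigma>\<in>F. \<Sum>xs\<in>set_pmf Q. ennreal ((1/2) ^ n * pmf Q xs) * ennreal (?w \<sigma> xs C))"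
      using F by (intro sum_mono2) auto
    finally show ?thesis .
  qed
  have avg: "(\<integral>\<^sup>+C. ennreal (?w \<sigma> xs C) \<partial>P) \<le> ennreal (q ^ m / q ^ d)" if "xs \<in> set_pmf Q" for \<sigma> xs
  proof -
    have xs: "set xs = {1..n}"
      using that set_random_order[of "{1..n}" n xs] by (simp add: Q_def)
    have "last_in xs S \<in> S" if S: "S \<subseteq> {1..n}" "card S = k" for S
    proof -
      have "S \<noteq> {}" using S k by auto
      then have "S \<inter> set xs \<noteq> {}" using S xs by auto
      from last_in_mem[OF this] show ?thesis by simp
    qed
    \<comment> \<open>Before any clause is revealed \<open>A\<close> is empty, leaving
      \<open>q ^ m / q ^ d\<close>.\<close>
    from nn_integral_satisfies_lasts_le[OF q \<delta> this k(2), of "{1..m}" "{}"] show ?thesis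
      by (simp add: P_def)
  qed
  have "emeasure (bind_pmf (random_xorsat k n m) (\<lambda>\<Phi>. map_pmf (\<lambda>\<sigma>. (\<Phi>, \<sigma>)) (DEC_UC \<Phi>)))
            {(\<Phi>, \<sigma>). \<sigma> \<in> solutions \<Phi>} = (\<integral>\<^sup>+C. emeasure (DEC_UC (\<Phi> C)) (solutions (\<Phi> C)) \<partial>P)"
    unfolding random_xorsat_def P_def[symmetric] \<Phi>_def[symmetric]
    by (simp add: vimage_def)
  also have "\<dots> \<le> (\<integral>\<^sup>+C. (\<Sum>\<sigma>\<in>F. \<Sum>xs\<in>set_pmf Q. ennreal ((1/2) ^ n * pmf Q xs) * ennreal (?w \<sigma> xs C)) \<partial>P)"
    using solve by (intro nn_integral_mono_AE) (auto simp: AE_measure_pmf_iff)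
  also have "\<dots> = (\<Sum>\<sigma>\<in>F. \<Sum>xs\<in>set_pmf Q. ennreal ((1/2) ^ n * pmf Q xs) * (\<integral>\<^sup>+C. ennreal (?w \<sigma> xs C) \<partial>P))"
    by (simp add: nn_integral_sum nn_integral_cmult)
  also have "\<dots> \<le> (\<Sum>\<sigma>\<in>F. \<Sum>xs\<in>set_pmf Q. ennreal ((1/2) ^ n * pmf Q xs) * ennreal (q ^ m / q ^ d))"
    using avg by (intro sum_mono mult_left_mono) auto
  also have "\<dots> = ennreal (\<Sum>\<sigma>\<in>F. \<Sum>xs\<in>set_pmf Q. (1/2) ^ n * pmf Q xs * (q ^ m / q ^ d))"
  proof -
    have nonneg: "0 \<le> (1/2) ^ n * pmf Q xs * (q ^ m / q ^ d)" for xs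
      using q0 by simp
    have "ennreal ((1/2) ^ n * pmf Q xs) * ennreal (q ^ m / q ^ d) = ennreal ((1/2) ^ n * pmf Q xs * (q ^ m / q ^ d))" for xs
      using q0 by (intro ennreal_mult[symmetric]) auto
    then show ?thesis
      by (simp only: sum_ennreal nonneg sum_nonneg)
  qed
  also have "(\<Sum>\<sigma>\<in>F. \<Sum>xs\<in>set_pmf Q. (1/2) ^ n * pmf Q xs * (q ^ m / q ^ d)) = q ^ m / q ^ d"
  proof -
    have "(\<Sum>xs\<in>set_pmf Q. (1/2) ^ n * pmf Q xs * (q ^ m / q ^ d)) = (1/2) ^ n * (q ^ m / q ^ d) * (\<Sum>xs\<in>set_pmf Q. pmf Q xs)"
      unfolding sum_distrib_left by (intro sum.cong refl) (simp only: mult_ac)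
    also have "\<dots> = (1/2) ^ n * (q ^ m / q ^ d)"
      using Q by (simp add: sum_pmf_eq_1)
    finally show ?thesis by (simp add: F power_one_over)
  qed
  finally show ?thesis
    using q0 by (simp add: measure_pmf.emeasure_eq_measure)
qed

section \<open>Choice of constants and the limit\<close>

lemma r_core_nonneg: "0 \<le> r_core k"
  \<comment> \<open>The value 0 belongs to the set, since there the condition reads
    \<open>Q > 0\<close>.\<close>
  unfolding r_core_def by (intro cSup_upper) (auto intro!: bdd_aboveI[of _ 1])

theorem theorem2:
  fixes k :: nat and r :: real
  assumes "k \<ge> 9"
    and "r \<in> {r_core k<..<r_sat k}"
  shows "(\<lambda>n. measure_pmf.prob
            (bind_pmf (random_xorsat k n (nat \<lfloor>r * real n\<rfloor>))
               (\<lambda>\<Phi>. map_pmf (\<lambda>\<sigma>. (\<Phi>, \<sigma>)) (DEC_UC \<Phi>)))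
            {(\<Phi>, \<sigma>). \<sigma> \<in> solutions \<Phi>})
         \<longlonglongrightarrow> 0"
proof -
  have r: "r > 0" using assms(2) r_core_nonneg[of k] by auto
  define m where "m n = nat \<lfloor>r * real n\<rfloor>" for n
  \<comment> \<open>Half of the clauses pay for the first \<open>d n\<close> last variables; the
    other half yields the decay.\<close>
  define d where "d n = m n div 2" for n
  \<comment> \<open>For \<open>d n \<ge> r * n / 4\<close>, the ratio of \<open>d n choose k\<close>
    to \<open>n choose k\<close> is at least \<open>(d n / k) ^ k / n ^ k\<close>, hence at least
    this power. The minimum ensures \<open>\<delta> \<le> 1\<close>.\<close>
  define \<delta> where "\<delta> = min 1 ((r / (4 * real k)) ^ k)"
  define q where "q = 1 - \<delta> / 2"
  have \<delta>: "0 < \<delta>" "\<delta> \<le> 1" using r assms(1) by (auto simp: \<delta>_def)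
  then have q: "0 < q" "q < 1" by (auto simp: q_def)
  have d_lower: "r * real n / 2 - 1 \<le> real (d n)" for n
  proof -
    have "r * real n - 1 \<le> real (m n)" using r by (simp add: m_def)
    moreover have "real (m n) \<le> 2 * real (d n) + 1" unfolding d_def by simp
    ultimately show ?thesis by linarith
  qed
  have lin: "filterlim (\<lambda>n. r * real n / 2 - 1) at_top sequentially"
    using r by real_asymp
  have d_top: "filterlim d at_top sequentially"
  proof -
    have "filterlim (\<lambda>n. real (d n)) at_top sequentially"
      by (rule filterlim_at_top_mono[OF lin]) (use d_lower in auto)
    then show ?thesis by (simp add: filterlim_sequentially_iff_filterlim_real)
  qed
  have ev: "eventually (\<lambda>n. measure_pmf.prob
            (bind_pmf (random_xorsat k n (m n)) (\<lambda>\<Phi>. map_pmf (\<lambda>\<sigma>. (\<Phi>, \<sigma>)) (DEC_UC \<Phi>)))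
            {(\<Phi>, \<sigma>). \<sigma> \<in> solutions \<Phi>} \<le> q ^ d n) sequentially"
    using eventually_ge_at_top[of "max k (nat \<lceil>4 / r\<rceil>)"]
      filterlim_at_top[THEN iffD1, rule_format, OF d_top, of k]
  proof eventually_elim
    case (elim n)
    \<comment> \<open>Then \<open>r * n / 4 \<ge> 1\<close> absorbs the rounding loss in
      \<open>d_lower\<close>.\<close>
    have "4 / r \<le> real n" using elim(1) by linarith
    then have "r * real n \<ge> 4" using r by (simp add: field_simps)
    then have dn: "r * real n / 4 \<le> real (d n)" using d_lower[of n] by linarith
    have "\<delta> * real (n choose k) \<le> (r / (4 * real k)) ^ k * real n ^ k"
      using binomial_le_pow[of k n] elim(1) r
      by (intro mult_mono) (auto simp: \<delta>_def simp flip: of_nat_power)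
    also have "\<dots> = ((r * real n / 4) / real k) ^ k"
      by (simp flip: power_mult_distrib)
    also have "\<dots> \<le> (real (d n) / real k) ^ k"
      using dn r by (intro power_mono divide_right_mono) auto
    also have "\<dots> \<le> real (d n choose k)"
      using elim(2) by (rule binomial_ge_n_over_k_pow_k)
    finally have "measure_pmf.prob
            (bind_pmf (random_xorsat k n (m n)) (\<lambda>\<Phi>. map_pmf (\<lambda>\<sigma>. (\<Phi>, \<sigma>)) (DEC_UC \<Phi>)))
            {(\<Phi>, \<sigma>). \<sigma> \<in> solutions \<Phi>} \<le> q ^ m n / q ^ d n"
      using \<delta> elim(1) assms(1) by (intro prob_DEC_UC_solves_le[OF q_def]) auto
    also have "\<dots> = q ^ (m n - d n)"
      using q by (simp add: power_diff d_def)
    also have "\<dots> \<le> q ^ d n"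
      using q by (intro power_decreasing) (auto simp: d_def)
    finally show ?case .
  qed
  have lim: "(\<lambda>n. q ^ d n) \<longlonglongrightarrow> 0"
    using q by (intro filterlim_compose[OF LIMSEQ_power_zero d_top]) auto
  show ?thesis
    unfolding m_def[symmetric]
    by (rule tendsto_sandwich[OF _ ev tendsto_const lim]) (intro always_eventually allI measure_nonneg)
qed

end
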